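(* Let $\mathcal{G}=\begin{pmatrix}\mathcal{A}&\mathcal{M}\\ \mathcal{N}&\mathcal{B}\end{pmatrix}$ be a generalized matrix algebra whose modules $\mathcal{M}$ and $\mathcal{N}$ are $2$-torsion free. Let $\mathcal{L}:\mathcal{G}\to\mathcal{G}$ be a Lie derivation, written in its standard presentation with data $(m_0,n_0,P,Q,f,g,h_{\mathcal{A}},h_{\mathcal{B}})$ (recalled in the context). Then $\mathcal{L}$ is proper if and only if there exist linear mappings $\ell_{\mathcal{A}}:\mathcal{A}\to Z(\mathcal{A})$ and $\ell_{\mathcal{B}}:\mathcal{B}\to Z(\mathcal{B})$ satisfying the following conditions: (A) $P-\ell_{\mathcal{A}}$ and $Q-\ell_{\mathcal{B}}$ are derivations on $\mathcal{A}$ and $\mathcal{B}$, respectively; (B) $\ell_{\mathcal{A}}(a)\oplus h_{\mathcal{A}}(a)\in Z(\mathcal{G})$ and $h_{\mathcal{B}}(b)\oplus \ell_{\mathcal{B}}(b)\in Z(\mathcal{G})$ for all $a\in\mathcal{A}$, $b\in\mathcal{B}$; (C) $\ell_{\mathcal{A}}(mn)=h_{\mathcal{B}}(nm)$ and $\ell_{\mathcal{B}}(nm)=h_{\mathcal{A}}(mn)$ for all $m\in\mathcal{M}$, $n\in\mathcal{N}$.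
   Context: All algebras are unital algebras over a fixed commutative unital ring $\mathbf{R}$; linear means $\mathbf{R}$-linear; $Z(\cdot)$ denotes the center; $[a,b]=ab-ba$. A module $\mathcal{M}$ is $2$-torsion free if $2m=0$ implies $m=0$ for $m\in\mathcal{M}$. Generalized matrix algebra: a Morita context consists of unital algebras $\mathcal{A},\mathcal{B}$, an $(\mathcal{A},\mathcal{B})$-bimodule $\mathcal{M}$, a $(\mathcal{B},\mathcal{A})$-bimodule $\mathcal{N}$, and bimodule homomorphisms $\Phi:\mathcal{M}\otimes_{\mathcal{B}}\mathcal{N}\to\mathcal{A}$, $\Psi:\mathcal{N}\otimes_{\mathcal{A}}\mathcal{M}\to\mathcal{B}$ such that, writing $mn=\Phi(m\otimes n)$ and $nm=\Psi(n\otimes m)$, one has $(mn)m'=m(nm')$ and $(nm)n'=n(mn')$ for all $m,m'\in\mathcal{M}$, $n,n'\in\mathcal{N}$. Then the set $\mathcal{G}$ of matrices $\begin{pmatrix}a&m\\ n&b\end{pmatrix}$ ($a\in\mathcal{A}$, $m\in\mathcal{M}$, $n\in\mathcal{N}$, $b\in\mathcal{B}$), with the usual matrix operations, is an algebra, called a generalized matrix algebra; it is assumed that at least one of $\mathcal{M},\mathcal{N}$ is nonzero. Write $a\oplus b=\begin{pmatrix}a&0\\0&b\end{pmatrix}\in\mathcal{G}$. The center is $Z(\mathcal{G})=\{a\oplus b: a\in Z(\mathcal{A}),\,b\in Z(\mathcal{B}),\ am=mb,\ na=bn\ \text{for all } m\in\mathcal{M},n\in\mathcal{N}\}$. A derivation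 of an algebra $\mathcal{C}$ is a linear map $\mathcal{D}:\mathcal{C}\to\mathcal{C}$ with $\mathcal{D}(xy)=\mathcal{D}(x)y+x\mathcal{D}(y)$. A Lie derivation is a linear map $\mathcal{L}:\mathcal{C}\to\mathcal{C}$ with $\mathcal{L}([x,y])=[\mathcal{L}(x),y]+[x,\mathcal{L}(y)]$. A Lie derivation $\mathcal{L}$ is proper if $\mathcal{L}=\mathcal{D}+\tau$ with $\mathcal{D}:\mathcal{C}\to\mathcal{C}$ a derivation and $\tau:\mathcal{C}\to Z(\mathcal{C})$ linear. Standard presentation of a Lie derivation (known fact): a linear map $\mathcal{L}$ on $\mathcal{G}$ is a Lie derivation if and only if $$\mathcal{L}\begin{pmatrix}a&m\\ n&b\end{pmatrix}=\begin{pmatrix}P(a)-mn_0-m_0n+h_{\mathcal{B}}(b)& am_0-m_0b+f(m)\\ n_0a-bn_0+g(n)& h_{\mathcal{A}}(a)+n_0m+nm_0+Q(b)\end{pmatrix}$$ for some $m_0\in\mathcal{M}$, $n_0\in\mathcal{N}$ and linear maps $P:\mathcal{A}\to\mathcal{A}$, $Q:\mathcal{B}\to\mathcal{B}$, $f:\mathcal{M}\to\mathcal{M}$, $g:\mathcal{N}\to\mathcal{N}$, $h_{\mathcal{B}}:\mathcal{B}\to Z(\mathcal{A})$, $h_{\mathcal{A}}:\mathcal{A}\to Z(\mathcal{B})$ such that, for all $a,a'\in\mathcal{A}$, $b,b'\in\mathcal{B}$, $m\in\mathcal{M}$, $n\in\mathcal{N}$: (a) $P,Q$ are Lie derivations;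 (b) $h_{\mathcal{B}}([b,b'])=0$ and $h_{\mathcal{A}}([a,a'])=0$; (c) $f(am)=P(a)m-mh_{\mathcal{A}}(a)+af(m)$ and $f(mb)=mQ(b)-h_{\mathcal{B}}(b)m+f(m)b$; (d) $g(na)=nP(a)-h_{\mathcal{A}}(a)n+g(n)a$ and $g(bn)=Q(b)n-nh_{\mathcal{B}}(b)+bg(n)$; (e) $P(mn)-h_{\mathcal{B}}(nm)=mg(n)+f(m)n$ and $Q(nm)-h_{\mathcal{A}}(mn)=g(n)m+nf(m)$. *)

theory Defs
  imports Complex_Main "HOL-Library.Product_Plus"
begin

text \<open>
  Rings are carried by types of class \<open>comm_ring_1\<close> and \<open>ring_1\<close>, modules by types of class
  \<open>ab_group_add\<close> with an explicit scalar multiplication (locale \<open>module\<close>); linear maps are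
  \<open>module_hom\<close>. These classes entail \<open>0 \<noteq> 1\<close>, which costs nothing here: a zero ring \<open>R\<close>, \<open>A\<close>
  or \<open>B\<close> forces both modules of a Morita context to vanish.
\<close>

section \<open>Algebras, derivations and Lie derivations\<close>

locale unital_algebra = module scale
  for scale :: "'r::comm_ring_1 \<Rightarrow> 'a::ring_1 \<Rightarrow> 'a" +
  assumes scale_mult_left: "scale r x * y = scale r (x * y)"
    and scale_mult_right: "x * scale r y = scale r (x * y)"

text \<open>
  The following notions take the multiplication as an argument, because the product of a
  generalized matrix algebra depends on the Morita context and is not a class operation.
\<close>

definition center :: "('c \<Rightarrow> 'c \<Rightarrow> 'c) \<Rightarrow> 'c set" where
  "center mul = {z. \<forall>x. mul z x = mul x z}"

definition commutator :: "('c \<Rightarrow> 'c \<Rightarrow> 'c) \<Rightarrow> 'c \<Rightarrow> 'c \<Rightarrow> 'c::ab_group_add" where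
  "commutator mul x y = mul x y - mul y x"

definition derivation ::
  "('r::comm_ring_1 \<Rightarrow> 'c \<Rightarrow> 'c) \<Rightarrow> ('c \<Rightarrow> 'c \<Rightarrow> 'c) \<Rightarrow> ('c::ab_group_add \<Rightarrow> 'c) \<Rightarrow> bool" where
  "derivation scale mul D \<longleftrightarrow>
     module_hom scale scale D \<and> (\<forall>x y. D (mul x y) = mul (D x) y + mul x (D y))"

definition lie_derivation ::
  "('r::comm_ring_1 \<Rightarrow> 'c \<Rightarrow> 'c) \<Rightarrow> ('c \<Rightarrow> 'c \<Rightarrow> 'c) \<Rightarrow> ('c::ab_group_add \<Rightarrow> 'c) \<Rightarrow> bool" where
  "lie_derivation scale mul L \<longleftrightarrow>
     module_hom scale scale L \<and>
     (\<forall>x y. L (commutator mul x y) = commutator mul (L x) y + commutator mul x (L y))"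

definition central_linear ::
  "('r::comm_ring_1 \<Rightarrow> 'b \<Rightarrow> 'b) \<Rightarrow> ('r \<Rightarrow> 'c \<Rightarrow> 'c) \<Rightarrow> ('c \<Rightarrow> 'c \<Rightarrow> 'c) \<Rightarrow>
     ('b::ab_group_add \<Rightarrow> 'c::ab_group_add) \<Rightarrow> bool" where
  "central_linear scale scale' mul h \<longleftrightarrow> module_hom scale scale' h \<and> range h \<subseteq> center mul"

definition proper_lie_derivation ::
  "('r::comm_ring_1 \<Rightarrow> 'c \<Rightarrow> 'c) \<Rightarrow> ('c \<Rightarrow> 'c \<Rightarrow> 'c) \<Rightarrow> ('c::ab_group_add \<Rightarrow> 'c) \<Rightarrow> bool" where
  "proper_lie_derivation scale mul L \<longleftrightarrow>
     lie_derivation scale mul L \<and>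
     (\<exists>D \<tau>. derivation scale mul D \<and> central_linear scale scale mul \<tau> \<and>
            (\<forall>x. L x = D x + \<tau> x))"

definition two_torsion_free :: "'m::ab_group_add itself \<Rightarrow> bool" where
  "two_torsion_free _ \<longleftrightarrow> (\<forall>x::'m. x + x = 0 \<longrightarrow> x = 0)"


section \<open>Bimodules and Morita contexts\<close>

text \<open>
  As usual for algebras over \<open>R\<close>, both actions on a bimodule induce the same \<open>R\<close>-module
  structure; this is the content of the four \<open>scale\<close> axioms.
\<close>

locale bimodule =
  A: unital_algebra scaleA + B: unital_algebra scaleB + M: module scaleM
  for scaleA :: "'r::comm_ring_1 \<Rightarrow> 'a::ring_1 \<Rightarrow> 'a"
    and scaleB :: "'r \<Rightarrow> 'b::ring_1 \<Rightarrow> 'b"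
    and scaleM :: "'r \<Rightarrow> 'm::ab_group_add \<Rightarrow> 'm"
    and lact :: "'a \<Rightarrow> 'm \<Rightarrow> 'm"
    and ract :: "'m \<Rightarrow> 'b \<Rightarrow> 'm" +
  assumes lact_add_left: "lact (a + a') m = lact a m + lact a' m"
    and lact_add_right: "lact a (m + m') = lact a m + lact a m'"
    and lact_one: "lact 1 m = m"
    and lact_mult: "lact (a * a') m = lact a (lact a' m)"
    and ract_add_left: "ract (m + m') b = ract m b + ract m' b"
    and ract_add_right: "ract m (b + b') = ract m b + ract m b'"
    and ract_one: "ract m 1 = m"
    and ract_mult: "ract m (b * b') = ract (ract m b) b'"
    and lact_ract: "lact a (ract m b) = ract (lact a m) b"
    and lact_scale_left: "lact (scaleA r a) m = scaleM r (lact a m)"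
    and lact_scale_right: "lact a (scaleM r m) = scaleM r (lact a m)"
    and ract_scale_left: "ract (scaleM r m) b = scaleM r (ract m b)"
    and ract_scale_right: "ract m (scaleB r b) = scaleM r (ract m b)"

text \<open>
  A bimodule homomorphism \<open>M \<otimes>\<^sub>B N \<rightarrow> A\<close>, given through the universal property of the
  tensor product as the biadditive \<open>B\<close>-balanced map \<open>p m n = \<Phi> (m \<otimes> n)\<close>. Linearity
  over \<open>R\<close> follows from linearity over \<open>A\<close>.
\<close>

definition tensor_bimodule_hom ::
  "('a::ring_1 \<Rightarrow> 'm \<Rightarrow> 'm) \<Rightarrow> ('m \<Rightarrow> 'b \<Rightarrow> 'm) \<Rightarrow> ('b::ring_1 \<Rightarrow> 'n \<Rightarrow> 'n) \<Rightarrow> ('n \<Rightarrow> 'a \<Rightarrow> 'n) \<Rightarrow>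
     ('m::ab_group_add \<Rightarrow> 'n::ab_group_add \<Rightarrow> 'a) \<Rightarrow> bool" where
  "tensor_bimodule_hom lM rM lN rN p \<longleftrightarrow>
     (\<forall>m m' n. p (m + m') n = p m n + p m' n) \<and>
     (\<forall>m n n'. p m (n + n') = p m n + p m n') \<and>
     (\<forall>m b n. p (rM m b) n = p m (lN b n)) \<and>
     (\<forall>a m n. p (lM a m) n = a * p m n) \<and>
     (\<forall>m n a. p m (rN n a) = p m n * a)"

record ('r, 'a, 'b, 'm, 'n) morita_data =
  scaleA :: "'r \<Rightarrow> 'a \<Rightarrow> 'a"
  scaleB :: "'r \<Rightarrow> 'b \<Rightarrow> 'b"
  scaleM :: "'r \<Rightarrow> 'm \<Rightarrow> 'm"
  scaleN :: "'r \<Rightarrow> 'n \<Rightarrow> 'n"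
  actAM :: "'a \<Rightarrow> 'm \<Rightarrow> 'm"
  actMB :: "'m \<Rightarrow> 'b \<Rightarrow> 'm"
  actBN :: "'b \<Rightarrow> 'n \<Rightarrow> 'n"
  actNA :: "'n \<Rightarrow> 'a \<Rightarrow> 'n"
  pairMN :: "'m \<Rightarrow> 'n \<Rightarrow> 'a"
  pairNM :: "'n \<Rightarrow> 'm \<Rightarrow> 'b"

locale morita_context =
  fixes C :: "('r::comm_ring_1, 'a::ring_1, 'b::ring_1, 'm::ab_group_add, 'n::ab_group_add) morita_data"
  assumes bimodule_M: "bimodule (scaleA C) (scaleB C) (scaleM C) (actAM C) (actMB C)"
    and bimodule_N: "bimodule (scaleB C) (scaleA C) (scaleN C) (actBN C) (actNA C)"
    and hom_MN: "tensor_bimodule_hom (actAM C) (actMB C) (actBN C) (actNA C) (pairMN C)"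
    and hom_NM: "tensor_bimodule_hom (actBN C) (actNA C) (actAM C) (actMB C) (pairNM C)"
    and assoc_MNM: "actAM C (pairMN C m n) m' = actMB C m (pairNM C n m')"
    and assoc_NMN: "actBN C (pairNM C n m) n' = actNA C n (pairMN C m n')"


section \<open>Generalized matrix algebras\<close>

text \<open>
  The tuple \<open>(a, m, n, b)\<close> is the matrix with rows \<open>(a, m)\<close> and \<open>(n, b)\<close>; addition is the
  componentwise addition of tuples.
\<close>

type_synonym ('a, 'b, 'm, 'n) gmat = "'a \<times> 'm \<times> 'n \<times> 'b"

definition gm_scale ::
  "('r, 'a, 'b, 'm, 'n) morita_data \<Rightarrow> 'r \<Rightarrow> ('a, 'b, 'm, 'n) gmat \<Rightarrow> ('a, 'b, 'm, 'n) gmat" where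
  "gm_scale C r = (\<lambda>(a, m, n, b). (scaleA C r a, scaleM C r m, scaleN C r n, scaleB C r b))"

definition gm_mult ::
  "('r, 'a::ring_1, 'b::ring_1, 'm::ab_group_add, 'n::ab_group_add) morita_data \<Rightarrow>
     ('a, 'b, 'm, 'n) gmat \<Rightarrow> ('a, 'b, 'm, 'n) gmat \<Rightarrow> ('a, 'b, 'm, 'n) gmat" where
  "gm_mult C = (\<lambda>(a, m, n, b) (a', m', n', b').
     (a * a' + pairMN C m n', actAM C a m' + actMB C m b',
      actNA C n a' + actBN C b n', pairNM C n m' + b * b'))"

definition gm_diag :: "'a \<Rightarrow> 'b \<Rightarrow> ('a, 'b, 'm::zero, 'n::zero) gmat" where
  "gm_diag a b = (a, 0, 0, b)"

locale generalized_matrix_algebra = morita_context C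
  for C :: "('r::comm_ring_1, 'a::ring_1, 'b::ring_1, 'm::ab_group_add, 'n::ab_group_add) morita_data" +
  assumes nonzero_module: "(\<exists>m::'m. m \<noteq> 0) \<or> (\<exists>n::'n. n \<noteq> 0)"

definition standard_presentation ::
  "('r::comm_ring_1, 'a::ring_1, 'b::ring_1, 'm::ab_group_add, 'n::ab_group_add) morita_data \<Rightarrow>
     (('a, 'b, 'm, 'n) gmat \<Rightarrow> ('a, 'b, 'm, 'n) gmat) \<Rightarrow>
     'm \<Rightarrow> 'n \<Rightarrow> ('a \<Rightarrow> 'a) \<Rightarrow> ('b \<Rightarrow> 'b) \<Rightarrow> ('m \<Rightarrow> 'm) \<Rightarrow> ('n \<Rightarrow> 'n) \<Rightarrow>
     ('a \<Rightarrow> 'b) \<Rightarrow> ('b \<Rightarrow> 'a) \<Rightarrow> bool" where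
  "standard_presentation C L m0 n0 P Q f g hA hB \<longleftrightarrow>
     (\<forall>a m n b. L (a, m, n, b) =
        (P a - pairMN C m n0 - pairMN C m0 n + hB b,
         actAM C a m0 - actMB C m0 b + f m,
         actNA C n0 a - actBN C b n0 + g n,
         hA a + pairNM C n0 m + pairNM C n m0 + Q b)) \<and>
     module_hom (scaleM C) (scaleM C) f \<and>
     module_hom (scaleN C) (scaleN C) g \<and>
     central_linear (scaleB C) (scaleA C) (*) hB \<and>
     central_linear (scaleA C) (scaleB C) (*) hA \<and>
     lie_derivation (scaleA C) (*) P \<and>
     lie_derivation (scaleB C) (*) Q \<and>
     (\<forall>b b'. hB (commutator (*) b b') = 0) \<and>
     (\<forall>a a'. hA (commutator (*) a a') = 0) \<and>
     (\<forall>a m. f (actAM C a m) = actAM C (P a) m - actMB C m (hA a) + actAM C a (f m)) \<and>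
     (\<forall>m b. f (actMB C m b) = actMB C m (Q b) - actAM C (hB b) m + actMB C (f m) b) \<and>
     (\<forall>n a. g (actNA C n a) = actNA C n (P a) - actBN C (hA a) n + actNA C (g n) a) \<and>
     (\<forall>b n. g (actBN C b n) = actBN C (Q b) n - actNA C n (hB b) + actBN C b (g n)) \<and>
     (\<forall>m n. P (pairMN C m n) - hB (pairNM C n m) = pairMN C m (g n) + pairMN C (f m) n) \<and>
     (\<forall>m n. Q (pairNM C n m) - hA (pairMN C m n) = pairNM C (g n) m + pairNM C n (f m))"


section \<open>The matrices form a unital algebra with the expected center\<close>

context morita_context
begin

interpretation M: bimodule "scaleA C" "scaleB C" "scaleM C" "actAM C" "actMB C"
  by (rule bimodule_M)

interpretation N: bimodule "scaleB C" "scaleA C" "scaleN C" "actBN C" "actNA C"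
  by (rule bimodule_N)

lemma act_zero:
  "actAM C a 0 = 0" "actAM C 0 m = 0" "actMB C m 0 = 0" "actMB C 0 b = 0"
  "actBN C b 0 = 0" "actBN C 0 n = 0" "actNA C n 0 = 0" "actNA C 0 a = 0"
  using M.lact_add_right[of a 0 0] M.lact_add_left[of 0 0 m]
    M.ract_add_right[of m 0 0] M.ract_add_left[of 0 0 b]
    N.lact_add_right[of b 0 0] N.lact_add_left[of 0 0 n]
    N.ract_add_right[of n 0 0] N.ract_add_left[of 0 0 a]
  by auto

lemma pair_add:
  "pairMN C (m + m') n = pairMN C m n + pairMN C m' n"
  "pairMN C m (n + n') = pairMN C m n + pairMN C m n'"
  "pairNM C (n + n') m = pairNM C n m + pairNM C n' m"
  "pairNM C n (m + m') = pairNM C n m + pairNM C n m'"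
  using hom_MN hom_NM by (simp_all add: tensor_bimodule_hom_def)

lemma pair_act:
  "pairMN C (actMB C m b) n = pairMN C m (actBN C b n)"
  "pairMN C (actAM C a m) n = a * pairMN C m n"
  "pairMN C m (actNA C n a) = pairMN C m n * a"
  "pairNM C (actNA C n a) m = pairNM C n (actAM C a m)"
  "pairNM C (actBN C b n) m = b * pairNM C n m"
  "pairNM C n (actMB C m b) = pairNM C n m * b"
  using hom_MN hom_NM by (simp_all add: tensor_bimodule_hom_def)

lemma pair_zero:
  "pairMN C 0 n = 0" "pairMN C m 0 = 0" "pairNM C 0 m = 0" "pairNM C n 0 = 0"
  using pair_add(1)[of 0 0 n] pair_add(2)[of m 0 0] pair_add(3)[of 0 0 m] pair_add(4)[of n 0 0]
  by auto

lemma pair_scale: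
  "pairMN C (scaleM C r m) n = scaleA C r (pairMN C m n)"
  "pairMN C m (scaleN C r n) = scaleA C r (pairMN C m n)"
  "pairNM C (scaleN C r n) m = scaleB C r (pairNM C n m)"
  "pairNM C n (scaleM C r m) = scaleB C r (pairNM C n m)"
proof -
  have "scaleM C r m = actAM C (scaleA C r 1) m" "scaleM C r m = actMB C m (scaleB C r 1)"
    "scaleN C r n = actBN C (scaleB C r 1) n" "scaleN C r n = actNA C n (scaleA C r 1)"
    by (simp_all add: M.lact_scale_left M.lact_one M.ract_scale_right M.ract_one
        N.lact_scale_left N.lact_one N.ract_scale_right N.ract_one)
  then show
    "pairMN C (scaleM C r m) n = scaleA C r (pairMN C m n)"
    "pairMN C m (scaleN C r n) = scaleA C r (pairMN C m n)"
    "pairNM C (scaleN C r n) m = scaleB C r (pairNM C n m)"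
    "pairNM C n (scaleM C r m) = scaleB C r (pairNM C n m)"
    by (metis pair_act(2) M.A.scale_mult_left mult_1_left,
        metis pair_act(3) M.A.scale_mult_right mult_1_right,
        metis pair_act(5) M.B.scale_mult_left mult_1_left,
        metis pair_act(6) M.B.scale_mult_right mult_1_right)
qed

lemma module_gm_scale: "module (gm_scale C)"
  by unfold_locales
    (auto simp: gm_scale_def M.A.scale_right_distrib M.B.scale_right_distrib
      M.M.scale_right_distrib N.M.scale_right_distrib M.A.scale_left_distrib
      M.B.scale_left_distrib M.M.scale_left_distrib N.M.scale_left_distrib)

lemma gm_mult_assoc: "gm_mult C (gm_mult C x y) z = gm_mult C x (gm_mult C y z)"
  by (cases x; cases y; cases z)
    (simp add: gm_mult_def pair_add pair_act M.lact_add_left M.lact_add_right M.ract_add_left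
      M.ract_add_right N.lact_add_left N.lact_add_right N.ract_add_left N.ract_add_right
      M.lact_mult M.ract_mult N.lact_mult N.ract_mult M.lact_ract N.lact_ract
      assoc_MNM assoc_NMN algebra_simps)

lemma gm_mult_add_left: "gm_mult C (x + y) z = gm_mult C x z + gm_mult C y z"
  by (cases x; cases y; cases z)
    (simp add: gm_mult_def pair_add M.lact_add_left M.ract_add_left
      N.lact_add_left N.ract_add_left algebra_simps)

lemma gm_mult_add_right: "gm_mult C x (y + z) = gm_mult C x y + gm_mult C x z"
  by (cases x; cases y; cases z)
    (simp add: gm_mult_def pair_add M.lact_add_right M.ract_add_right
      N.lact_add_right N.ract_add_right algebra_simps)

lemma gm_mult_one:
  "gm_mult C (gm_diag 1 1) x = x" "gm_mult C x (gm_diag 1 1) = x"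
  by (cases x; simp add: gm_mult_def gm_diag_def act_zero pair_zero
      M.lact_one M.ract_one N.lact_one N.ract_one)+

lemma gm_mult_scale:
  "gm_mult C (gm_scale C r x) y = gm_scale C r (gm_mult C x y)"
  "gm_mult C x (gm_scale C r y) = gm_scale C r (gm_mult C x y)"
  by (cases x; cases y; simp add: gm_mult_def gm_scale_def pair_scale
      M.A.scale_mult_left M.A.scale_mult_right M.B.scale_mult_left M.B.scale_mult_right
      M.lact_scale_left M.lact_scale_right M.ract_scale_left M.ract_scale_right
      N.lact_scale_left N.lact_scale_right N.ract_scale_left N.ract_scale_right
      M.A.scale_right_distrib M.B.scale_right_distrib
      M.M.scale_right_distrib N.M.scale_right_distrib)+

lemma center_gm_mult:
  "center (gm_mult C) =
     {gm_diag a b | a b. a \<in> center (*) \<and> b \<in> center (*) \<and>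
        (\<forall>m. actAM C a m = actMB C m b) \<and> (\<forall>n. actNA C n a = actBN C b n)}" (is "_ = ?Z")
proof
  show "center (gm_mult C) \<subseteq> ?Z"
  proof
    fix x assume x: "x \<in> center (gm_mult C)"
    obtain a m n b where x_eq: "x = (a, m, n, b)" by (cases x)
    have comm: "gm_mult C (a, m, n, b) y = gm_mult C y (a, m, n, b)" for y
      using x unfolding center_def x_eq by blast
    have "m = 0" "n = 0"
      using comm[of "(1, 0, 0, 0)"]
      by (simp_all add: gm_mult_def act_zero pair_zero M.lact_one N.ract_one)
    moreover have "a * a' = a' * a" for a'
      using comm[of "(a', 0, 0, 0)"] by (simp add: gm_mult_def act_zero pair_zero)
    moreover have "b * b' = b' * b" for b'
      using comm[of "(0, 0, 0, b')"] by (simp add: gm_mult_def act_zero pair_zero)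
    moreover have "actAM C a m' = actMB C m' b" for m'
      using comm[of "(0, m', 0, 0)"] by (simp add: gm_mult_def act_zero pair_zero)
    moreover have "actNA C n' a = actBN C b n'" for n'
      using comm[of "(0, 0, n', 0)"] by (simp add: gm_mult_def act_zero pair_zero)
    ultimately show "x \<in> ?Z"
      by (auto simp: x_eq gm_diag_def center_def)
  qed
  show "?Z \<subseteq> center (gm_mult C)"
    by (auto simp: center_def gm_diag_def gm_mult_def act_zero pair_zero)
qed

end

end

theory Submission
  imports Defs
begin

text \<open>
  Suppose first that \<open>L = D + \<tau>\<close>. For \<open>x = a \<oplus> 0\<close> the lower right entry of \<open>D\<close> vanishes, since
  a derivation maps \<open>x = x (1 \<oplus> 0)\<close> to \<open>D(x) (1 \<oplus> 0) + x D(1 \<oplus> 0)\<close>. Hence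
  \<open>h\<^sub>A(a)\<close> is the lower right entry of the central element \<open>\<tau>(a \<oplus> 0)\<close>, and its upper left entry
  is taken as \<open>\<ell>\<^sub>A(a)\<close>; symmetrically for \<open>\<ell>\<^sub>B\<close>. The upper left entry of \<open>D\<close> on
  \<open>A \<oplus> 0\<close> is then \<open>P - \<ell>\<^sub>A\<close>, which is therefore a derivation. Expanding \<open>D\<close> on the product of
  the off-diagonal matrices given by \<open>m\<close> and \<open>n\<close> yields \<open>P(mn) - \<ell>\<^sub>A(mn) = m g(n) + f(m) n\<close>, and
  the standard presentation identifies the right-hand side with \<open>P(mn) - h\<^sub>B(nm)\<close>.

  Conversely, put \<open>\<tau>(a, m, n, b) = (\<ell>\<^sub>A(a) + h\<^sub>B(b)) \<oplus> (h\<^sub>A(a) + \<ell>\<^sub>B(b))\<close>, which is central by (B).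
  Subtracting it from \<open>L\<close> replaces \<open>P\<close>, \<open>Q\<close> by \<open>P - \<ell>\<^sub>A\<close>, \<open>Q - \<ell>\<^sub>B\<close> and removes \<open>h\<^sub>A\<close>, \<open>h\<^sub>B\<close>. By
  (B) and (C), all correction terms in the conditions on \<open>f\<close> and \<open>g\<close> disappear in the same way, and
  what is left is exactly the set of conditions making the remaining map a derivation
  (lemma \<open>derivation_gm_mapI\<close>).
\<close>

lemma center_add_closed:
  fixes mul :: "'c::ab_group_add \<Rightarrow> 'c \<Rightarrow> 'c"
  assumes "\<And>x y z. mul (x + y) z = mul x z + mul y z"
    and "\<And>x y z. mul x (y + z) = mul x y + mul x z"
    and "x \<in> center mul" and "y \<in> center mul"
  shows "x + y \<in> center mul"
  using assms by (simp add: center_def)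

section \<open>Derivations of a generalized matrix algebra\<close>

context morita_context
begin

interpretation M: bimodule "scaleA C" "scaleB C" "scaleM C" "actAM C" "actMB C"
  by (rule bimodule_M)

interpretation N: bimodule "scaleB C" "scaleA C" "scaleN C" "actBN C" "actNA C"
  by (rule bimodule_N)

lemma act_diff:
  "actAM C a (m - m') = actAM C a m - actAM C a m'"
  "actAM C (a - a') m = actAM C a m - actAM C a' m"
  "actMB C (m - m') b = actMB C m b - actMB C m' b"
  "actMB C m (b - b') = actMB C m b - actMB C m b'"
  "actBN C b (n - n') = actBN C b n - actBN C b n'"
  "actBN C (b - b') n = actBN C b n - actBN C b' n"
  "actNA C (n - n') a = actNA C n a - actNA C n' a"
  "actNA C n (a - a') = actNA C n a - actNA C n a'"
  using M.lact_add_right[of a "m - m'" m'] M.lact_add_left[of "a - a'" a' m]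
    M.ract_add_left[of "m - m'" m' b] M.ract_add_right[of m "b - b'" b']
    N.lact_add_right[of b "n - n'" n'] N.lact_add_left[of "b - b'" b' n]
    N.ract_add_left[of "n - n'" n' a] N.ract_add_right[of n "a - a'" a']
  by (simp_all add: eq_diff_eq)

lemma pair_diff:
  "pairMN C (m - m') n = pairMN C m n - pairMN C m' n"
  "pairMN C m (n - n') = pairMN C m n - pairMN C m n'"
  "pairNM C (n - n') m = pairNM C n m - pairNM C n' m"
  "pairNM C n (m - m') = pairNM C n m - pairNM C n m'"
  using pair_add(1)[of "m - m'" m' n] pair_add(2)[of m "n - n'" n']
    pair_add(3)[of "n - n'" n' m] pair_add(4)[of n "m - m'" m']
  by (simp_all add: eq_diff_eq)

lemma gm_diag_center_iff:
  "(gm_diag a b :: ('a, 'b, 'm, 'n) gmat) \<in> center (gm_mult C) \<longleftrightarrow>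
     a \<in> center (*) \<and> b \<in> center (*) \<and>
     (\<forall>m. actAM C a m = actMB C m b) \<and> (\<forall>n. actNA C n a = actBN C b n)"
  by (auto simp: center_gm_mult gm_diag_def)

lemma center_off_diagonal:
  assumes "(z :: ('a, 'b, 'm, 'n) gmat) \<in> center (gm_mult C)"
  obtains a b where "z = (a, 0, 0, b)" and "a \<in> center (*)" and "b \<in> center (*)"
  using assms by (auto simp: center_gm_mult gm_diag_def)

text \<open>
  The terms with \<open>m0\<close> and \<open>n0\<close> form the inner derivation \<open>x \<mapsto> [x, k]\<close> for the matrix \<open>k\<close> with
  rows \<open>(0, m0)\<close> and \<open>(- n0, 0)\<close>; the other terms act entrywise.
\<close>

lemma derivation_gm_mapI:
  assumes P: "derivation (scaleA C) (*) P" and Q: "derivation (scaleB C) (*) Q"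
    and f: "module_hom (scaleM C) (scaleM C) f" and g: "module_hom (scaleN C) (scaleN C) g"
    and fam: "\<And>a m. f (actAM C a m) = actAM C (P a) m + actAM C a (f m)"
    and fmb: "\<And>m b. f (actMB C m b) = actMB C m (Q b) + actMB C (f m) b"
    and gna: "\<And>n a. g (actNA C n a) = actNA C n (P a) + actNA C (g n) a"
    and gbn: "\<And>b n. g (actBN C b n) = actBN C (Q b) n + actBN C b (g n)"
    and Pmn: "\<And>m n. P (pairMN C m n) = pairMN C m (g n) + pairMN C (f m) n"
    and Qnm: "\<And>n m. Q (pairNM C n m) = pairNM C (g n) m + pairNM C n (f m)"
    and D: "\<And>a m n b. D (a, m, n, b) =
        (P a - pairMN C m n0 - pairMN C m0 n,
         actAM C a m0 - actMB C m0 b + f m,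
         actNA C n0 a - actBN C b n0 + g n,
         pairNM C n0 m + pairNM C n m0 + Q b)"
  shows "derivation (gm_scale C) (gm_mult C) D"
proof -
  have P_hom: "module_hom (scaleA C) (scaleA C) P" and P_mult: "P (x * y) = P x * y + x * P y"
    for x y
    using P by (auto simp: derivation_def)
  have Q_hom: "module_hom (scaleB C) (scaleB C) Q" and Q_mult: "Q (x * y) = Q x * y + x * Q y"
    for x y
    using Q by (auto simp: derivation_def)
  note add = module_hom.add[OF P_hom] module_hom.add[OF Q_hom] module_hom.add[OF f] module_hom.add[OF g]
  note scale = module_hom.scale[OF P_hom] module_hom.scale[OF Q_hom]
    module_hom.scale[OF f] module_hom.scale[OF g]
  have "module_hom (gm_scale C) (gm_scale C) D"
    unfolding module_hom_iff
  proof (intro conjI allI)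
    show "D (x + y) = D x + D y" for x y
      by (cases x; cases y)
        (simp add: D add pair_add M.lact_add_left M.ract_add_right N.lact_add_left
          N.ract_add_right algebra_simps)
    show "D (gm_scale C r x) = gm_scale C r (D x)" for r x
      by (cases x)
        (simp add: D gm_scale_def scale pair_scale M.lact_scale_left M.ract_scale_right
          N.lact_scale_left N.ract_scale_right M.A.scale_right_distrib M.B.scale_right_distrib
          M.M.scale_right_distrib N.M.scale_right_distrib M.A.scale_right_diff_distrib
          M.M.scale_right_diff_distrib N.M.scale_right_diff_distrib)
  qed (rule module_gm_scale)+
  moreover have "D (gm_mult C x y) = gm_mult C (D x) y + gm_mult C x (D y)" for x y
    by (cases x; cases y)
      (simp add: D gm_mult_def add P_mult Q_mult fam fmb gna gbn Pmn Qnm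
        pair_add pair_diff pair_act act_diff M.lact_add_left M.lact_add_right M.ract_add_left
        M.ract_add_right N.lact_add_left N.lact_add_right N.ract_add_left N.ract_add_right
        M.lact_mult M.ract_mult N.lact_mult N.ract_mult M.lact_ract N.lact_ract
        assoc_MNM assoc_NMN algebra_simps)
  ultimately show ?thesis
    by (simp add: derivation_def)
qed

section \<open>The criterion for properness\<close>

lemma proper_lie_derivation_iff:
  assumes lie: "lie_derivation (gm_scale C) (gm_mult C) L"
    and pres: "standard_presentation C L m0 n0 P Q f g hA hB"
  shows "proper_lie_derivation (gm_scale C) (gm_mult C) L \<longleftrightarrow>
    (\<exists>lA lB.
       central_linear (scaleA C) (scaleA C) (*) lA \<and>
       central_linear (scaleB C) (scaleB C) (*) lB \<and>
       derivation (scaleA C) (*) (\<lambda>a. P a - lA a) \<and>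
       derivation (scaleB C) (*) (\<lambda>b. Q b - lB b) \<and>
       (\<forall>a. (gm_diag (lA a) (hA a) :: ('a, 'b, 'm, 'n) gmat) \<in> center (gm_mult C)) \<and>
       (\<forall>b. (gm_diag (hB b) (lB b) :: ('a, 'b, 'm, 'n) gmat) \<in> center (gm_mult C)) \<and>
       (\<forall>m n. lA (pairMN C m n) = hB (pairNM C n m)) \<and>
       (\<forall>m n. lB (pairNM C n m) = hA (pairMN C m n)))" (is "_ \<longleftrightarrow> (\<exists>lA lB. ?conds lA lB)")
proof -
  have L: "L (a, m, n, b) =
        (P a - pairMN C m n0 - pairMN C m0 n + hB b,
         actAM C a m0 - actMB C m0 b + f m,
         actNA C n0 a - actBN C b n0 + g n,
         hA a + pairNM C n0 m + pairNM C n m0 + Q b)" for a m n b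
    using pres by (simp add: standard_presentation_def)
  have f: "module_hom (scaleM C) (scaleM C) f" and g: "module_hom (scaleN C) (scaleN C) g"
    and hB: "module_hom (scaleB C) (scaleA C) hB" and hA: "module_hom (scaleA C) (scaleB C) hA"
    and P: "module_hom (scaleA C) (scaleA C) P" and Q: "module_hom (scaleB C) (scaleB C) Q"
    using pres by (auto simp: standard_presentation_def central_linear_def lie_derivation_def)
  have fam: "f (actAM C a m) = actAM C (P a) m - actMB C m (hA a) + actAM C a (f m)"
    and fmb: "f (actMB C m b) = actMB C m (Q b) - actAM C (hB b) m + actMB C (f m) b"
    and gna: "g (actNA C n a) = actNA C n (P a) - actBN C (hA a) n + actNA C (g n) a"
    and gbn: "g (actBN C b n) = actBN C (Q b) n - actNA C n (hB b) + actBN C b (g n)"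
    and Pmn: "P (pairMN C m n) - hB (pairNM C n m) = pairMN C m (g n) + pairMN C (f m) n"
    and Qnm: "Q (pairNM C n m) - hA (pairMN C m n) = pairNM C (g n) m + pairNM C n (f m)"
    for a m n b
    using pres by (simp_all add: standard_presentation_def)
  note zeros = act_zero pair_zero module_hom.zero[OF f] module_hom.zero[OF g] module_hom.zero[OF hA]
    module_hom.zero[OF hB] module_hom.zero[OF P] module_hom.zero[OF Q]
  show ?thesis
  proof
    assume "proper_lie_derivation (gm_scale C) (gm_mult C) L"
    then obtain D \<tau> where D: "derivation (gm_scale C) (gm_mult C) D"
      and \<tau>: "module_hom (gm_scale C) (gm_scale C) \<tau>"
      and \<tau>_center: "\<And>x. \<tau> x \<in> center (gm_mult C)" and L_eq: "\<And>x. L x = D x + \<tau> x"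
      unfolding proper_lie_derivation_def central_linear_def by blast
    define tA tB where "tA x = fst (\<tau> x)" and "tB x = snd (snd (snd (\<tau> x)))" for x
    have \<tau>_eq: "\<tau> x = (tA x, 0, 0, tB x)"
      and tA_center: "tA x \<in> center (*)" and tB_center: "tB x \<in> center (*)" for x
      using \<tau>_center[of x] by (auto elim!: center_off_diagonal simp: tA_def tB_def)
    have D_mult: "D (gm_mult C x y) = gm_mult C (D x) y + gm_mult C x (D y)" for x y
      using D unfolding derivation_def by blast
    have D_eq: "D (a, m, n, b) =
        (P a - pairMN C m n0 - pairMN C m0 n + hB b - tA (a, m, n, b),
         actAM C a m0 - actMB C m0 b + f m,
         actNA C n0 a - actBN C b n0 + g n,
         hA a + pairNM C n0 m + pairNM C n m0 + Q b - tB (a, m, n, b))" for a m n b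
    proof -
      have "D (a, m, n, b) = L (a, m, n, b) - \<tau> (a, m, n, b)"
        by (simp add: L_eq)
      then show ?thesis by (simp add: L \<tau>_eq)
    qed
    \<comment> \<open>These are the lower right entry of \<open>D(x (1 \<oplus> 0))\<close> for \<open>x = a \<oplus> 0\<close> and the upper left entry
      of \<open>D(y (0 \<oplus> 1))\<close> for \<open>y = 0 \<oplus> b\<close>; both vanish.\<close>
    have hA_eq: "hA a = tB (a, 0, 0, 0)" for a
      using D_mult[of "(a, 0, 0, 0)" "(1, 0, 0, 0)"] by (simp add: D_eq gm_mult_def zeros)
    have hB_eq: "hB b = tA (0, 0, 0, b)" for b
      using D_mult[of "(0, 0, 0, b)" "(0, 0, 0, 1)"] by (simp add: D_eq gm_mult_def zeros)
    define lA lB where "lA a = tA (a, 0, 0, 0)" and "lB b = tB (0, 0, 0, b)" for a b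
    have \<tau>_A: "\<tau> (a, 0, 0, 0) = gm_diag (lA a) (hA a)" for a
      by (simp add: \<tau>_eq lA_def hA_eq gm_diag_def)
    have \<tau>_B: "\<tau> (0, 0, 0, b) = gm_diag (hB b) (lB b)" for b
      by (simp add: \<tau>_eq lB_def hB_eq gm_diag_def)
    have lA: "module_hom (scaleA C) (scaleA C) lA"
      unfolding module_hom_iff
    proof (intro conjI allI)
      show "lA (x + y) = lA x + lA y" for x y
        using module_hom.add[OF \<tau>, of "(x, 0, 0, 0)" "(y, 0, 0, 0)"] by (simp add: \<tau>_A gm_diag_def)
      show "lA (scaleA C r x) = scaleA C r (lA x)" for r x
        using module_hom.scale[OF \<tau>, of r "(x, 0, 0, 0)"] by (simp add: \<tau>_A gm_diag_def gm_scale_def)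
    qed (rule M.A.module_axioms)+
    have lB: "module_hom (scaleB C) (scaleB C) lB"
      unfolding module_hom_iff
    proof (intro conjI allI)
      show "lB (x + y) = lB x + lB y" for x y
        using module_hom.add[OF \<tau>, of "(0, 0, 0, x)" "(0, 0, 0, y)"] by (simp add: \<tau>_B gm_diag_def)
      show "lB (scaleB C r x) = scaleB C r (lB x)" for r x
        using module_hom.scale[OF \<tau>, of r "(0, 0, 0, x)"] by (simp add: \<tau>_B gm_diag_def gm_scale_def)
    qed (rule M.B.module_axioms)+
    have "P (a * a') - lA (a * a') = (P a - lA a) * a' + a * (P a' - lA a')" for a a'
      using D_mult[of "(a, 0, 0, 0)" "(a', 0, 0, 0)"] by (simp add: D_eq gm_mult_def zeros lA_def)
    then have derA: "derivation (scaleA C) (*) (\<lambda>a. P a - lA a)"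
      using module_pair.module_hom_sub[OF _ P lA] M.A.module_axioms
      by (simp add: derivation_def module_pair_def)
    have "Q (b * b') - lB (b * b') = (Q b - lB b) * b' + b * (Q b' - lB b')" for b b'
      using D_mult[of "(0, 0, 0, b)" "(0, 0, 0, b')"] by (simp add: D_eq gm_mult_def zeros lB_def)
    then have derB: "derivation (scaleB C) (*) (\<lambda>b. Q b - lB b)"
      using module_pair.module_hom_sub[OF _ Q lB] M.B.module_axioms
      by (simp add: derivation_def module_pair_def)
    have "P (pairMN C m n) - lA (pairMN C m n) = pairMN C m (g n) + pairMN C (f m) n" for m n
      using D_mult[of "(0, m, 0, 0)" "(0, 0, n, 0)"]
      by (simp add: D_eq gm_mult_def zeros lA_def add.commute)
    then have lA_pair: "lA (pairMN C m n) = hB (pairNM C n m)" for m n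
      using Pmn[of m n] by (metis diff_left_imp_eq)
    have "Q (pairNM C n m) - lB (pairNM C n m) = pairNM C (g n) m + pairNM C n (f m)" for m n
      using D_mult[of "(0, 0, n, 0)" "(0, m, 0, 0)"]
      by (simp add: D_eq gm_mult_def zeros lB_def add.commute)
    then have lB_pair: "lB (pairNM C n m) = hA (pairMN C m n)" for m n
      using Qnm[of n m] by (metis diff_left_imp_eq)
    have "?conds lA lB"
      using lA lB derA derB lA_pair lB_pair \<tau>_center tA_center tB_center
      by (auto simp: central_linear_def lA_def lB_def
          simp flip: \<tau>_A[unfolded lA_def] \<tau>_B[unfolded lB_def])
    then show "\<exists>lA lB. ?conds lA lB" by blast
  next
    assume "\<exists>lA lB. ?conds lA lB"
    then obtain lA lB where "?conds lA lB" by blast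
    then have lA: "module_hom (scaleA C) (scaleA C) lA" and lB: "module_hom (scaleB C) (scaleB C) lB"
      and derA: "derivation (scaleA C) (*) (\<lambda>a. P a - lA a)"
      and derB: "derivation (scaleB C) (*) (\<lambda>b. Q b - lB b)"
      and cA: "\<And>a. (gm_diag (lA a) (hA a) :: ('a, 'b, 'm, 'n) gmat) \<in> center (gm_mult C)"
      and cB: "\<And>b. (gm_diag (hB b) (lB b) :: ('a, 'b, 'm, 'n) gmat) \<in> center (gm_mult C)"
      and lA_pair: "\<And>m n. lA (pairMN C m n) = hB (pairNM C n m)"
      and lB_pair: "\<And>m n. lB (pairNM C n m) = hA (pairMN C m n)"
      by (auto simp: central_linear_def)
    define \<tau> :: "('a, 'b, 'm, 'n) gmat \<Rightarrow> ('a, 'b, 'm, 'n) gmat"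
      where "\<tau> = (\<lambda>(a, m, n, b). gm_diag (lA a) (hA a) + gm_diag (hB b) (lB b))"
    have "module_hom (gm_scale C) (gm_scale C) \<tau>"
      unfolding module_hom_iff
    proof (intro conjI allI)
      show "\<tau> (x + y) = \<tau> x + \<tau> y" for x y
        by (cases x; cases y)
          (simp add: \<tau>_def gm_diag_def module_hom.add[OF lA] module_hom.add[OF lB]
            module_hom.add[OF hA] module_hom.add[OF hB] algebra_simps)
      show "\<tau> (gm_scale C r x) = gm_scale C r (\<tau> x)" for r x
        by (cases x)
          (simp add: \<tau>_def gm_diag_def gm_scale_def module_hom.scale[OF lA] module_hom.scale[OF lB]
            module_hom.scale[OF hA] module_hom.scale[OF hB] M.A.scale_right_distrib
            M.B.scale_right_distrib)
    qed (rule module_gm_scale)+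
    moreover have "\<tau> x \<in> center (gm_mult C)" for x
      by (cases x)
        (simp add: \<tau>_def center_add_closed[OF gm_mult_add_left gm_mult_add_right cA cB])
    ultimately have \<tau>: "central_linear (gm_scale C) (gm_scale C) (gm_mult C) \<tau>"
      by (auto simp: central_linear_def)
    have actA: "actAM C (lA a) m = actMB C m (hA a)" "actNA C n (lA a) = actBN C (hA a) n"
      and actB: "actMB C m (lB b) = actAM C (hB b) m" "actBN C (lB b) n = actNA C n (hB b)"
      for a b m n
      using cA[of a] cB[of b] by (simp_all add: gm_diag_center_iff)
    have der: "derivation (gm_scale C) (gm_mult C) (\<lambda>x. L x - \<tau> x)"
    proof (rule derivation_gm_mapI)
      show "derivation (scaleA C) (*) (\<lambda>a. P a - lA a)"
        and "derivation (scaleB C) (*) (\<lambda>b. Q b - lB b)"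
        by (rule derA, rule derB)
      show "module_hom (scaleM C) (scaleM C) f" and "module_hom (scaleN C) (scaleN C) g"
        by (rule f, rule g)
      show "P (pairMN C m n) - lA (pairMN C m n) = pairMN C m (g n) + pairMN C (f m) n" for m n
        using Pmn by (simp add: lA_pair)
      show "Q (pairNM C n m) - lB (pairNM C n m) = pairNM C (g n) m + pairNM C n (f m)" for n m
        using Qnm by (simp add: lB_pair)
      show "f (actAM C a m) = actAM C (P a - lA a) m + actAM C a (f m)" for a m
        by (simp add: fam act_diff actA)
      show "f (actMB C m b) = actMB C m (Q b - lB b) + actMB C (f m) b" for m b
        by (simp add: fmb act_diff actB)
      show "g (actNA C n a) = actNA C n (P a - lA a) + actNA C (g n) a" for n a
        by (simp add: gna act_diff actA)
      show "g (actBN C b n) = actBN C (Q b - lB b) n + actBN C b (g n)" for b n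
        by (simp add: gbn act_diff actB)
      show "L (a, m, n, b) - \<tau> (a, m, n, b) =
          (P a - lA a - pairMN C m n0 - pairMN C m0 n,
           actAM C a m0 - actMB C m0 b + f m,
           actNA C n0 a - actBN C b n0 + g n,
           pairNM C n0 m + pairNM C n m0 + (Q b - lB b))" for a m n b
        by (simp add: L \<tau>_def gm_diag_def)
    qed
    show "proper_lie_derivation (gm_scale C) (gm_mult C) L"
      unfolding proper_lie_derivation_def using lie der \<tau>
      by (intro conjI exI[of _ "\<lambda>x. L x - \<tau> x"] exI[of _ \<tau>]) simp_all
  qed
qed

end

theorem theorem2p2:
  fixes C :: "('r::comm_ring_1, 'a::ring_1, 'b::ring_1, 'm::ab_group_add, 'n::ab_group_add) morita_data"
    and L :: "('a, 'b, 'm, 'n) gmat \<Rightarrow> ('a, 'b, 'm, 'n) gmat"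
    and m0 :: 'm and n0 :: 'n
    and P :: "'a \<Rightarrow> 'a" and Q :: "'b \<Rightarrow> 'b"
    and f :: "'m \<Rightarrow> 'm" and g :: "'n \<Rightarrow> 'n"
    and hA :: "'a \<Rightarrow> 'b" and hB :: "'b \<Rightarrow> 'a"
  assumes "generalized_matrix_algebra C"
    and "two_torsion_free TYPE('m)" and "two_torsion_free TYPE('n)"
    and "lie_derivation (gm_scale C) (gm_mult C) L"
    and "standard_presentation C L m0 n0 P Q f g hA hB"
  shows "proper_lie_derivation (gm_scale C) (gm_mult C) L \<longleftrightarrow>
    (\<exists>lA lB.
       central_linear (scaleA C) (scaleA C) (*) lA \<and>
       central_linear (scaleB C) (scaleB C) (*) lB \<and>
       derivation (scaleA C) (*) (\<lambda>a. P a - lA a) \<and>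
       derivation (scaleB C) (*) (\<lambda>b. Q b - lB b) \<and>
       (\<forall>a. gm_diag (lA a) (hA a) \<in> center (gm_mult C)) \<and>
       (\<forall>b. gm_diag (hB b) (lB b) \<in> center (gm_mult C)) \<and>
       (\<forall>m n. lA (pairMN C m n) = hB (pairNM C n m)) \<and>
       (\<forall>m n. lB (pairNM C n m) = hA (pairMN C m n)))"
proof -
  interpret generalized_matrix_algebra C by fact
  show ?thesis
    using assms(4,5) by (rule proper_lie_derivation_iff)
qed

end
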